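(* There is a universal constant $c>0$ such that, for every sufficiently large $n$, one can find a centered isotropic log-concave random vector $X^{(n)}\in\mathbb{R}^n$ satisfying \[ \int_{S^{n-1}} W_1\bigl(\mathrm{Law}(\langle X^{(n)},\theta\rangle),\gamma_1\bigr)\,d\sigma_{n-1}(\theta)\ge \frac{c}{n}. \] One may take $X^{(n)}$ to have independent coordinates, each distributed as $E-1$, where $E$ has the exponential distribution with mean one.
   Context: A random vector $X$ in $\mathbb{R}^n$ is centered and isotropic if $\mathsf{E}X=0$ and $\mathsf{E}XX^T=I_n$; it is log-concave if its law has a density of the form $e^{-\mathcal V}$ on a convex set (zero outside), with $\mathcal V$ convex. $\gamma_1$ is the standard Gaussian law on $\mathbb{R}$; $\sigma_{n-1}$ is the normalized rotation-invariant probability measure on the unit sphere $S^{n-1}$. $\mathrm{Law}(\langle X^{(n)},\theta\rangle)$ is the law with $\theta$ held fixed. For probability measures $\mu,\nu$ on $\mathbb{R}$ with finite first moments, $W_1(\mu,\nu)=\inf_{\pi}\int_{\mathbb{R}^2}|x-y|\,d\pi(x,y)$, the infimum over all probability measures $\pi$ on $\mathbb{R}^2$ with marginals $\mu$ and $\nu$. "Universal" means independent of $n$. *)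

theory Defs
  imports "HOL-Probability.Probability"
begin

text \<open>
  The dimension is quantified inside the theorem, so \<open>\<real>\<^sup>n\<close> is the space of the finite
  product measure over the index set \<open>{..<n}\<close>: its elements are the functions
  \<open>nat \<Rightarrow> real\<close> that are \<open>undefined\<close> outside \<open>{..<n}\<close>.
\<close>

definition lebesgue_Rn :: "nat \<Rightarrow> (nat \<Rightarrow> real) measure" where
  "lebesgue_Rn n = Pi\<^sub>M {..<n} (\<lambda>_. lborel)"

definition inner_Rn :: "nat \<Rightarrow> (nat \<Rightarrow> real) \<Rightarrow> (nat \<Rightarrow> real) \<Rightarrow> real" where
  "inner_Rn n x y = (\<Sum>i<n. x i * y i)"

definition centered :: "nat \<Rightarrow> 'a measure \<Rightarrow> ('a \<Rightarrow> nat \<Rightarrow> real) \<Rightarrow> bool" where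
  "centered n M X \<longleftrightarrow>
     (\<forall>i<n. integrable M (\<lambda>\<omega>. X \<omega> i) \<and> (\<integral>\<omega>. X \<omega> i \<partial>M) = 0)"

definition isotropic :: "nat \<Rightarrow> 'a measure \<Rightarrow> ('a \<Rightarrow> nat \<Rightarrow> real) \<Rightarrow> bool" where
  "isotropic n M X \<longleftrightarrow>
     (\<forall>i<n. \<forall>j<n. integrable M (\<lambda>\<omega>. X \<omega> i * X \<omega> j) \<and>
        (\<integral>\<omega>. X \<omega> i * X \<omega> j \<partial>M) = (if i = j then 1 else 0))"

text \<open>
  The type \<open>nat \<Rightarrow> real\<close> carries no \<open>real_vector\<close> structure in the library, so
  \<open>convex\<close> and \<open>convex_on\<close> are restated for subsets of \<open>\<real>\<^sup>n\<close>.
\<close>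

definition segment_Rn ::
    "nat \<Rightarrow> real \<Rightarrow> (nat \<Rightarrow> real) \<Rightarrow> (nat \<Rightarrow> real) \<Rightarrow> nat \<Rightarrow> real" where
  "segment_Rn n t x y = (\<lambda>i\<in>{..<n}. (1 - t) * x i + t * y i)"

definition convex_Rn :: "nat \<Rightarrow> (nat \<Rightarrow> real) set \<Rightarrow> bool" where
  "convex_Rn n K \<longleftrightarrow>
     K \<subseteq> space (lebesgue_Rn n) \<and>
     (\<forall>x\<in>K. \<forall>y\<in>K. \<forall>t\<in>{0..1}. segment_Rn n t x y \<in> K)"

definition convex_on_Rn ::
    "nat \<Rightarrow> (nat \<Rightarrow> real) set \<Rightarrow> ((nat \<Rightarrow> real) \<Rightarrow> real) \<Rightarrow> bool" where
  "convex_on_Rn n K V \<longleftrightarrow>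
     convex_Rn n K \<and>
     (\<forall>x\<in>K. \<forall>y\<in>K. \<forall>t\<in>{0..1}. V (segment_Rn n t x y) \<le> (1 - t) * V x + t * V y)"

definition log_concave :: "nat \<Rightarrow> 'a measure \<Rightarrow> ('a \<Rightarrow> nat \<Rightarrow> real) \<Rightarrow> bool" where
  "log_concave n M X \<longleftrightarrow>
     (\<exists>K V. convex_on_Rn n K V \<and>
        distributed M (lebesgue_Rn n) X (\<lambda>x. if x \<in> K then ennreal (exp (- V x)) else 0))"

definition sphere_Rn :: "nat \<Rightarrow> (nat \<Rightarrow> real) set" where
  "sphere_Rn n = {\<theta> \<in> space (lebesgue_Rn n). inner_Rn n \<theta> \<theta> = 1}"

definition orthogonal_mat :: "nat \<Rightarrow> (nat \<Rightarrow> nat \<Rightarrow> real) \<Rightarrow> bool" where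
  "orthogonal_mat n U \<longleftrightarrow>
     (\<forall>i<n. \<forall>j<n. (\<Sum>k<n. U k i * U k j) = (if i = j then 1 else 0) \<and>
                     (\<Sum>k<n. U i k * U j k) = (if i = j then 1 else 0))"

definition apply_mat ::
    "nat \<Rightarrow> (nat \<Rightarrow> nat \<Rightarrow> real) \<Rightarrow> (nat \<Rightarrow> real) \<Rightarrow> nat \<Rightarrow> real" where
  "apply_mat n U x = (\<lambda>i\<in>{..<n}. \<Sum>j<n. U i j * x j)"

text \<open>
  \<open>\<sigma>\<close> is the normalized rotation-invariant measure on the Borel sets of the unit sphere
  of \<open>\<real>\<^sup>n\<close>; it is unique for \<open>n > 0\<close>, and there is none for \<open>n = 0\<close>.
\<close>

definition uniform_on_sphere :: "nat \<Rightarrow> (nat \<Rightarrow> real) measure \<Rightarrow> bool" where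
  "uniform_on_sphere n \<sigma> \<longleftrightarrow>
     prob_space \<sigma> \<and>
     space \<sigma> = sphere_Rn n \<and>
     sets \<sigma> = sets (restrict_space (lebesgue_Rn n) (sphere_Rn n)) \<and>
     (\<forall>U. orthogonal_mat n U \<longrightarrow> distr \<sigma> \<sigma> (apply_mat n U) = \<sigma>)"

definition gamma1 :: "real measure" where
  "gamma1 = density lborel (\<lambda>x. ennreal (std_normal_density x))"

definition exp_minus_one_law :: "real measure" where
  "exp_minus_one_law =
     distr (density lborel (\<lambda>x. ennreal (exponential_density 1 x))) borel (\<lambda>x. x - 1)"

definition couplings :: "real measure \<Rightarrow> real measure \<Rightarrow> (real \<times> real) measure set" where
  "couplings \<mu> \<nu> =
     {\<pi>. prob_space \<pi> \<and> sets \<pi> = sets borel \<and> distr \<pi> borel fst = \<mu> \<and> distr \<pi> borel snd = \<nu>}"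

definition W1 :: "real measure \<Rightarrow> real measure \<Rightarrow> ennreal" where
  "W1 \<mu> \<nu> = (INF \<pi>\<in>couplings \<mu> \<nu>. \<integral>\<^sup>+ p. ennreal \<bar>fst p - snd p\<bar> \<partial>\<pi>)"

definition marginal_law ::
    "nat \<Rightarrow> 'a measure \<Rightarrow> ('a \<Rightarrow> nat \<Rightarrow> real) \<Rightarrow> (nat \<Rightarrow> real) \<Rightarrow> real measure" where
  "marginal_law n M X \<theta> = distr M borel (\<lambda>\<omega>. inner_Rn n (X \<omega>) \<theta>)"

end

theory Submission
  imports Defs
begin

text \<open>
  Since \<open>x \<mapsto> exp (\<i> * x)\<close> is 1-Lipschitz, \<open>W1\<close> dominates the difference of the characteristic
  functions at the point 1. For \<open>E - 1\<close> the characteristic function has modulus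
  \<open>1 / sqrt (1 + t\<^sup>2)\<close>, so by independence that of \<open>\<langle>X, \<theta>\<rangle>\<close> has modulus
  \<open>\<Prod>i. 1 / sqrt (1 + \<theta> i ^ 2)\<close> at 1. As \<open>1 + u \<le> exp (u - u\<^sup>2 / 6)\<close> on \<open>[0, 1]\<close>, this is at least
  \<open>exp (- 1 / 2) * (1 + (\<Sum>i. \<theta> i ^ 4) / 12)\<close>, while the Gaussian value is \<open>exp (- 1 / 2)\<close>.
  Cauchy--Schwarz gives \<open>(\<Sum>i. \<theta> i ^ 4) \<ge> 1 / n\<close> for every unit vector, so the bound \<open>c / n\<close> even
  holds pointwise on the sphere.
\<close>

section \<open>Wasserstein distance and characteristic functions\<close>

lemma norm_iexp_diff_le: "cmod (iexp x - iexp y) \<le> \<bar>x - y\<bar>"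
proof -
  have "iexp x - iexp y = iexp y * (iexp (x - y) - 1)"
    by (simp add: algebra_simps flip: exp_add)
  then have "cmod (iexp x - iexp y) = cmod (iexp (x - y) - 1)"
    by (simp add: norm_mult)
  also have "\<dots> \<le> \<bar>x - y\<bar>"
    using iexp_approx1[of "x - y" 0] by simp
  finally show ?thesis .
qed

text \<open>Under any coupling the difference of the characteristic functions is the expectation of
  \<open>iexp (t * x) - iexp (t * y)\<close>, whose modulus is at most
  \<open>\<bar>t\<bar> * \<bar>x - y\<bar>\<close>. The bound therefore holds for each coupling and
  passes to the infimum.\<close>

lemma char_diff_le_W1:
  "ennreal (cmod (char \<mu> t - char \<nu> t) / \<bar>t\<bar>) \<le> W1 \<mu> \<nu>"
  unfolding W1_def
proof (intro INF_greatest)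
  fix \<pi> assume \<pi>: "\<pi> \<in> couplings \<mu> \<nu>"
  then have "prob_space \<pi>" and sets_\<pi>: "sets \<pi> = sets borel"
    and \<mu>: "distr \<pi> borel fst = \<mu>" and \<nu>: "distr \<pi> borel snd = \<nu>"
    unfolding couplings_def by blast+
  interpret prob_space \<pi> by fact
  have [measurable]: "fst \<in> borel_measurable \<pi>" "snd \<in> borel_measurable \<pi>"
    unfolding measurable_cong_sets[OF sets_\<pi> refl]
    by (intro borel_measurable_continuous_onI continuous_intros)+
  have int: "integrable \<pi> (\<lambda>p. iexp (t * fst p))" "integrable \<pi> (\<lambda>p. iexp (t * snd p))"
    by (intro integrable_iexp; simp)+
  show "ennreal (cmod (char \<mu> t - char \<nu> t) / \<bar>t\<bar>) \<le> (\<integral>\<^sup>+ p. ennreal \<bar>fst p - snd p\<bar> \<partial>\<pi>)"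
  \<comment> \<open>For \<open>t = 0\<close> the left side is 0, since division by zero yields 0;
    only \<open>t \<noteq> 0\<close> needs an argument.\<close>
  proof (cases "t = 0")
    case False
    have "ennreal (cmod (char \<mu> t - char \<nu> t))
        = ennreal (cmod (CLINT p|\<pi>. iexp (t * fst p) - iexp (t * snd p)))"
      unfolding \<mu>[symmetric] \<nu>[symmetric] char_def
      by (subst Bochner_Integration.integral_diff[OF int]) (simp add: integral_distr)
    also have "\<dots> \<le> (\<integral>\<^sup>+ p. ennreal (cmod (iexp (t * fst p) - iexp (t * snd p))) \<partial>\<pi>)"
      by (intro integral_norm_bound_ennreal Bochner_Integration.integrable_diff int)
    also have "\<dots> \<le> (\<integral>\<^sup>+ p. ennreal \<bar>fst p - snd p\<bar> * ennreal \<bar>t\<bar> \<partial>\<pi>)"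
    proof (intro nn_integral_mono)
      fix p :: "real \<times> real"
      have "cmod (iexp (t * fst p) - iexp (t * snd p)) \<le> \<bar>fst p - snd p\<bar> * \<bar>t\<bar>"
        using norm_iexp_diff_le[of "t * fst p" "t * snd p"]
        by (simp add: mult.commute flip: right_diff_distrib abs_mult)
      then show "ennreal (cmod (iexp (t * fst p) - iexp (t * snd p)))
          \<le> ennreal \<bar>fst p - snd p\<bar> * ennreal \<bar>t\<bar>"
        by (simp add: ennreal_leI flip: ennreal_mult)
    qed
    also have "\<dots> = (\<integral>\<^sup>+ p. ennreal \<bar>fst p - snd p\<bar> \<partial>\<pi>) * ennreal \<bar>t\<bar>"
      by (intro nn_integral_multc) measurable
    finally have "ennreal (cmod (char \<mu> t - char \<nu> t)) / ennreal \<bar>t\<bar>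
        \<le> (\<integral>\<^sup>+ p. ennreal \<bar>fst p - snd p\<bar> \<partial>\<pi>) * ennreal \<bar>t\<bar> / ennreal \<bar>t\<bar>"
      by (rule divide_right_mono_ennreal)
    then show ?thesis
      using False by (simp add: divide_ennreal mult_divide_eq_ennreal)
  qed simp
qed

section \<open>Densities of finite product measures\<close>

text \<open>A product of sigma-finite measures is determined by its values on boxes, and there
  Tonelli factors the integral of the product density. This supplies the joint density that
  log-concavity asks for.\<close>

lemma PiM_density:
  assumes "finite I" and f: "\<And>i. i \<in> I \<Longrightarrow> f i \<in> borel_measurable (M i)"
    and M: "\<And>i. sigma_finite_measure (M i)"
    and D: "\<And>i. sigma_finite_measure (density (M i) (f i))"
  shows "Pi\<^sub>M I (\<lambda>i. density (M i) (f i)) = density (Pi\<^sub>M I M) (\<lambda>x. \<Prod>i\<in>I. f i (x i))"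
proof -
  interpret M: product_sigma_finite M
    using M by (simp add: product_sigma_finite_def)
  interpret D: product_sigma_finite "\<lambda>i. density (M i) (f i)"
    using D by (simp add: product_sigma_finite_def)
  note f[measurable]
  show ?thesis
  proof (rule D.PiM_eqI[symmetric, OF \<open>finite I\<close>])
    show "sets (density (Pi\<^sub>M I M) (\<lambda>x. \<Prod>i\<in>I. f i (x i))) = sets (Pi\<^sub>M I (\<lambda>i. density (M i) (f i)))"
      unfolding sets_density by (rule sets_PiM_cong) simp_all
    fix A assume A: "\<And>i. i \<in> I \<Longrightarrow> A i \<in> sets (density (M i) (f i))"
    then have A'[measurable]: "A i \<in> sets (M i)" if "i \<in> I" for i
      using that by simp
    have "emeasure (density (Pi\<^sub>M I M) (\<lambda>x. \<Prod>i\<in>I. f i (x i))) (Pi\<^sub>E I A)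
        = (\<integral>\<^sup>+ x. (\<Prod>i\<in>I. f i (x i)) * indicator (Pi\<^sub>E I A) x \<partial>Pi\<^sub>M I M)"
      using A' \<open>finite I\<close> by (intro emeasure_density sets_PiM_I_finite) auto
    \<comment> \<open>The indicator of the box factors only on the space of the product measure:
      membership in \<open>Pi\<^sub>E I A\<close> also demands extensionality.\<close>
    also have "\<dots> = (\<integral>\<^sup>+ x. (\<Prod>i\<in>I. f i (x i) * indicator (A i) (x i)) \<partial>Pi\<^sub>M I M)"
      using \<open>finite I\<close>
      by (intro nn_integral_cong)
         (auto simp: prod.distrib space_PiM PiE_iff indicator_def prod_zero_iff)
    also have "\<dots> = (\<Prod>i\<in>I. \<integral>\<^sup>+ x. f i x * indicator (A i) x \<partial>M i)"
      using \<open>finite I\<close> by (intro M.product_nn_integral_prod) auto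
    also have "\<dots> = (\<Prod>i\<in>I. emeasure (density (M i) (f i)) (A i))"
      using A' by (intro prod.cong) (auto simp: emeasure_density)
    finally show "emeasure (density (Pi\<^sub>M I M) (\<lambda>x. \<Prod>i\<in>I. f i (x i))) (Pi\<^sub>E I A)
        = (\<Prod>i\<in>I. emeasure (density (M i) (f i)) (A i))" .
  qed
qed

section \<open>The centered exponential law: density, moments, characteristic function\<close>

lemma exp_minus_one_law_eq_density:
  "exp_minus_one_law = density lborel (\<lambda>x. ennreal (exponential_density 1 (x + 1)))"
proof -
  have "(\<lambda>x. x - 1 :: real) = (+) (- 1)"
    by auto
  then have shift: "distr lborel borel (\<lambda>x. x - 1 :: real) = lborel"
    using lborel_distr_plus[of "- 1 :: real"] by simp
  \<comment> \<open>The density is pulled back along \<open>x - 1\<close>, where its argument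
    \<open>x + 1\<close> becomes \<open>x\<close> again; translation invariance of
    \<open>lborel\<close> then removes the inner \<open>distr\<close>.\<close>
  have "density (distr lborel borel (\<lambda>x. x - 1)) (\<lambda>x. ennreal (exponential_density 1 (x + 1)))
      = exp_minus_one_law"
    unfolding exp_minus_one_law_def by (subst density_distr) simp_all
  then show ?thesis
    unfolding shift by simp
qed

lemma sets_exp_minus_one_law [simp]: "sets exp_minus_one_law = sets borel"
  by (simp add: exp_minus_one_law_def)

lemma prob_space_exp_minus_one_law: "prob_space exp_minus_one_law"
  unfolding exp_minus_one_law_def
  by (intro prob_space.prob_space_distr prob_space_exponential_density) simp_all

lemma exp_minus_one_law_moments:
  shows "integrable exp_minus_one_law (\<lambda>x. x)" "(\<integral>x. x \<partial>exp_minus_one_law) = 0"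
    and "integrable exp_minus_one_law (\<lambda>x. x * x)" "(\<integral>x. x * x \<partial>exp_minus_one_law) = 1"
proof -
  let ?E = "density lborel (\<lambda>x. ennreal (exponential_density 1 x))"
  interpret prob_space ?E
    by (rule prob_space_exponential_density) simp
  have dist: "distributed ?E lborel (\<lambda>x. x) (exponential_density 1)"
    by (simp add: distributed_def distr_id2)
  have int: "integrable ?E (\<lambda>x. x)" "integrable ?E (\<lambda>x. x\<^sup>2)"
    \<comment> \<open>The exponential density is the Erlang density of shape 0, with i-th moment
      \<open>fact i\<close>. The values 1 and 2 give variance \<open>2 - 2 + 1 = 1\<close> after
      centering.\<close>
    using erlang_ith_moment_integrable[OF _ dist, of 1] erlang_ith_moment_integrable[OF _ dist, of 2]
    by simp_all
  have val: "(\<integral>x. x \<partial>?E) = 1" "(\<integral>x. x\<^sup>2 \<partial>?E) = 2"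
    using erlang_ith_moment[OF _ dist, of 1] erlang_ith_moment[OF _ dist, of 2] by simp_all
  have total: "prob UNIV = 1"
    using prob_space by simp
  have sq: "(x - 1) * (x - 1) = x\<^sup>2 - 2 * x + (1::real)" for x
    by (simp add: power2_eq_square algebra_simps)
  show "integrable exp_minus_one_law (\<lambda>x. x)"
    unfolding exp_minus_one_law_def
    by (subst integrable_distr_eq) (auto simp: int)
  show "(\<integral>x. x \<partial>exp_minus_one_law) = 0"
    unfolding exp_minus_one_law_def
    by (subst integral_distr) (auto simp: int val total)
  show "integrable exp_minus_one_law (\<lambda>x. x * x)"
    unfolding exp_minus_one_law_def
    by (subst integrable_distr_eq) (auto simp: sq int)
  show "(\<integral>x. x * x \<partial>exp_minus_one_law) = 1"
    unfolding exp_minus_one_law_def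
    by (subst integral_distr) (auto simp: sq int val total)
qed

text \<open>With \<open>z = \<i> * t - 1\<close> the integrand on the half-line is
  \<open>exp (x * z)\<close>, with antiderivative \<open>exp (x * z) / z\<close>. Since z has real
  part -1, it is nonzero and the boundary term at infinity vanishes.\<close>

lemma char_exponential:
  "char (density lborel (exponential_density 1)) t = 1 / (1 - \<i> * t)"
proof -
  let ?E = "density lborel (\<lambda>x. ennreal (exponential_density 1 x))"
  let ?z = "\<i> * of_real t - 1"
  let ?f = "\<lambda>x::real. exp (of_real x * ?z)"
  let ?g = "\<lambda>x. exponential_density 1 x *\<^sub>R iexp (t * x)"
  have "?z \<noteq> 0"
    by (auto simp: complex_eq_iff)
  interpret prob_space ?E
    by (rule prob_space_exponential_density) simp
  have "integrable ?E (\<lambda>x. iexp (t * x))"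
    by (intro integrable_iexp) simp_all
  then have g_integrable: "integrable lborel ?g"
    by (subst (asm) integrable_density) (simp_all add: exponential_density_nonneg)
  have f_eq_g: "indicator {0<..} x *\<^sub>R ?f x = indicator {0<..} x *\<^sub>R ?g x" for x
    by (simp add: exponential_density_def indicator_def scaleR_conv_of_real algebra_simps
        flip: exp_add exp_of_real)
  have "char ?E t = (CLINT x|lborel. ?g x)"
    unfolding char_def by (subst integral_density) (simp_all add: exponential_density_nonneg)
  \<comment> \<open>The density equals 1 at the origin, so passing to the open half-line changes the
    integrand at one point, a null set.\<close>
  also have "\<dots> = (CLINT x|lborel. indicator {0<..} x *\<^sub>R ?g x)"
  proof (intro integral_cong_AE)
    show "AE x in lborel. ?g x = indicator {0<..} x *\<^sub>R ?g x"
      using AE_lborel_singleton[of "0::real"]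
      by eventually_elim (auto simp: indicator_def exponential_density_def)
  qed simp_all
  also have "\<dots> = (LBINT x=0..\<infinity>. ?f x)"
    by (simp add: interval_lebesgue_integral_def einterval_eq set_lebesgue_integral_def f_eq_g
        zero_ereal_def)
  also have "\<dots> = 0 - 1 / ?z"
  proof (rule interval_integral_FTC_integrable[where F = "\<lambda>x. ?f x / ?z"])
    show "((\<lambda>x. ?f x / ?z) has_vector_derivative ?f x) (at x)" for x
      using \<open>?z \<noteq> 0\<close>
      by (auto intro!: derivative_eq_intros has_vector_derivative_real_field)
    show "set_integrable lborel (einterval 0 \<infinity>) ?f"
      unfolding set_integrable_def zero_ereal_def einterval_eq f_eq_g
      by (intro integrable_mult_indicator g_integrable) simp
    have "((\<lambda>x. ?f x / ?z) \<longlongrightarrow> ?f 0 / ?z) (at_right 0)"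
      using \<open>?z \<noteq> 0\<close> by (intro tendsto_intros)
    then show "(((\<lambda>x. ?f x / ?z) \<circ> real_of_ereal) \<longlongrightarrow> 1 / ?z) (at_right 0)"
      unfolding zero_ereal_def ereal_tendsto_simps by simp
    have "((\<lambda>x. exp (- x) / cmod ?z) \<longlongrightarrow> 0) at_top"
      by real_asymp
    then have "((\<lambda>x. ?f x / ?z) \<longlongrightarrow> 0) at_top"
      by (rule Lim_null_comparison[rotated]) (simp add: norm_divide norm_exp_eq_Re)
    then show "(((\<lambda>x. ?f x / ?z) \<circ> real_of_ereal) \<longlongrightarrow> 0) (at_left \<infinity>)"
      unfolding ereal_tendsto_simps .
  qed (auto intro!: continuous_intros)
  also have "\<dots> = 1 / (1 - \<i> * t)"
    using \<open>?z \<noteq> 0\<close> by (simp add: field_simps)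
  finally show ?thesis .
qed

text \<open>Centering only multiplies the characteristic function by the phase
  \<open>iexp (- t)\<close>, which the modulus does not see.\<close>

lemma cmod_char_exp_minus_one_law:
  "cmod (char exp_minus_one_law t) = 1 / sqrt (1 + t\<^sup>2)"
proof -
  let ?E = "density lborel (\<lambda>x. ennreal (exponential_density 1 x))"
  have "char exp_minus_one_law t = (CLINT x|?E. iexp (- t) * iexp (t * x))"
    unfolding char_def exp_minus_one_law_def
    by (subst integral_distr) (simp_all add: algebra_simps flip: exp_add)
  also have "\<dots> = iexp (- t) * char ?E t"
    by (simp add: char_def)
  finally have "cmod (char exp_minus_one_law t) = cmod (1 / (1 - \<i> * t))"
    by (simp only: norm_mult char_exponential norm_exp_i_times mult_1_left)
  then show ?thesis
    by (simp only: norm_divide) (simp add: cmod_def)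
qed

section \<open>Elementary inequalities behind the fourth-power gain\<close>

text \<open>For the exponent v, \<open>u\<^sup>2 \<le> u\<close> gives
  \<open>v \<ge> 5 / 6 * u\<close>. Hence \<open>v\<^sup>2 / 2\<close> is at least
  \<open>25 / 72 * u\<^sup>2\<close>, which outweighs the subtracted \<open>u\<^sup>2 / 6\<close>,
  and the quadratic Taylor bound for \<open>exp v\<close> applies.\<close>

lemma one_plus_le_exp_quadratic:
  fixes u :: real
  assumes "0 \<le> u" "u \<le> 1"
  shows "1 + u \<le> exp (u - u\<^sup>2 / 6)"
proof -
  have "u\<^sup>2 \<le> u"
    using assms by (simp add: power2_eq_square mult_left_le)
  define v where "v = u - u\<^sup>2 / 6"
  have v: "5 / 6 * u \<le> v" "0 \<le> v"
    using \<open>u\<^sup>2 \<le> u\<close> assms by (auto simp: v_def)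
  have "(5 / 6 * u)\<^sup>2 \<le> v\<^sup>2"
    using v assms by (intro power_mono) auto
  then have "25 * u\<^sup>2 \<le> 36 * v\<^sup>2"
    by (simp add: power_mult_distrib power_divide)
  then have "u\<^sup>2 / 6 \<le> v\<^sup>2 / 2"
    using zero_le_power2[of v] by linarith
  then have "1 + u \<le> 1 + v + v\<^sup>2 / 2"
    by (simp add: v_def)
  also have "\<dots> \<le> exp v"
    using exp_lower_Taylor_quadratic[of v] v by simp
  finally show ?thesis
    by (simp add: v_def)
qed

text \<open>The preceding inequality is used with \<open>u = (\<theta> i)\<^sup>2\<close>, which is
  at most 1 on a unit vector. The square root halves its exponent, turning 6 into 12, and
  Cauchy-Schwarz against the constant vector 1 bounds the sum of fourth powers below.\<close>

lemma prod_inverse_sqrt_lower_bound: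
  fixes \<theta> :: "'i \<Rightarrow> real"
  assumes "finite I" and unit: "(\<Sum>i\<in>I. \<theta> i ^ 2) = 1"
  shows "exp (- 1 / 2) * (1 + 1 / (12 * card I)) \<le> (\<Prod>i\<in>I. 1 / sqrt (1 + (\<theta> i)\<^sup>2))"
proof -
  have "I \<noteq> {}"
    using unit by auto
  then have "card I > 0"
    using \<open>finite I\<close> by (simp add: card_gt_0_iff)
  have le1: "(\<theta> i)\<^sup>2 \<le> 1" if "i \<in> I" for i
    using member_le_sum[of i I "\<lambda>i. (\<theta> i)\<^sup>2"] that \<open>finite I\<close> unit by simp
  have "1 \<le> (\<Sum>i\<in>I. \<theta> i ^ 4) * card I"
    using Cauchy_Schwarz_ineq_sum[of "\<lambda>i. (\<theta> i)\<^sup>2" "\<lambda>_. 1" I] unit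
    by (simp flip: power_mult)
  then have "1 / card I \<le> (\<Sum>i\<in>I. \<theta> i ^ 4)"
    using \<open>card I > 0\<close> by (simp add: divide_le_eq)
  then have "1 + 1 / (12 * card I) \<le> 1 + (\<Sum>i\<in>I. \<theta> i ^ 4) / 12"
    by simp
  also have "\<dots> \<le> exp ((\<Sum>i\<in>I. \<theta> i ^ 4) / 12)"
    by (rule exp_ge_add_one_self)
  finally have "exp (- 1 / 2) * (1 + 1 / (12 * card I))
      \<le> exp (- 1 / 2) * exp ((\<Sum>i\<in>I. \<theta> i ^ 4) / 12)"
    by simp
  \<comment> \<open>The constant \<open>- 1 / 2\<close> is rewritten as minus half the sum of the
    squares, so that the exponential splits over the coordinates.\<close>
  also have "\<dots> = exp (\<Sum>i\<in>I. - (((\<theta> i)\<^sup>2 - \<theta> i ^ 4 / 6) / 2))"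
    by (simp add: sum_negf sum_subtractf unit diff_divide_distrib
        flip: exp_add sum_divide_distrib)
  also have "\<dots> = (\<Prod>i\<in>I. exp (- (((\<theta> i)\<^sup>2 - \<theta> i ^ 4 / 6) / 2)))"
    using \<open>finite I\<close> by (rule exp_sum)
  also have "\<dots> \<le> (\<Prod>i\<in>I. 1 / sqrt (1 + (\<theta> i)\<^sup>2))"
  proof (intro prod_mono conjI)
    fix i assume "i \<in> I"
    let ?e = "exp (((\<theta> i)\<^sup>2 - \<theta> i ^ 4 / 6) / 2)"
    have "?e\<^sup>2 = exp ((\<theta> i)\<^sup>2 - ((\<theta> i)\<^sup>2)\<^sup>2 / 6)"
      by (simp add: mult.commute flip: exp_double)
    then have "1 + (\<theta> i)\<^sup>2 \<le> ?e\<^sup>2"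
      using one_plus_le_exp_quadratic[of "(\<theta> i)\<^sup>2"] le1[OF \<open>i \<in> I\<close>] by simp
    then have "sqrt (1 + (\<theta> i)\<^sup>2) \<le> ?e"
      by (intro real_le_lsqrt) auto
    then have "inverse ?e \<le> inverse (sqrt (1 + (\<theta> i)\<^sup>2))"
      by (intro le_imp_inverse_le) (auto simp: add_pos_nonneg)
    then show "exp (- (((\<theta> i)\<^sup>2 - \<theta> i ^ 4 / 6) / 2)) \<le> 1 / sqrt (1 + (\<theta> i)\<^sup>2)"
      unfolding exp_minus by (simp add: inverse_eq_divide)
  qed simp
  finally show ?thesis .
qed

section \<open>The vector with independent centered exponential coordinates\<close>

context
  fixes n :: nat and M :: "(nat \<Rightarrow> real) measure"
  defines "M \<equiv> Pi\<^sub>M {..<n} (\<lambda>_. exp_minus_one_law)"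
begin

interpretation L: prob_space exp_minus_one_law
  by (rule prob_space_exp_minus_one_law)

interpretation M: prob_space M
  unfolding M_def by (rule prob_space_PiM) (rule prob_space_exp_minus_one_law)

lemma sets_product_law: "sets M = sets (lebesgue_Rn n)"
  unfolding M_def lebesgue_Rn_def by (rule sets_PiM_cong) simp_all

lemma product_law_component:
  assumes "i < n"
  shows "distr M borel (\<lambda>\<omega>. \<omega> i) = exp_minus_one_law"
proof -
  \<comment> \<open>Both target measures have the same sigma-algebra; the second is the one in which
    the projection law of a product is stated.\<close>
  have "distr M borel (\<lambda>\<omega>. \<omega> i) = distr M exp_minus_one_law (\<lambda>\<omega>. \<omega> i)"
    by (rule distr_cong) simp_all
  also have "\<dots> = exp_minus_one_law"
    unfolding M_def using assms by (intro distr_PiM_component prob_space_exp_minus_one_law) simp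
  finally show ?thesis .
qed

lemma measurable_product_law_component: "i < n \<Longrightarrow> (\<lambda>\<omega>. \<omega> i) \<in> borel_measurable M"
  unfolding measurable_cong_sets[OF sets_product_law refl] lebesgue_Rn_def
  using measurable_component_singleton[of i "{..<n}" "\<lambda>_. lborel"] by simp

text \<open>Independence amounts to the joint law being the product of the marginal laws, a
  criterion for nonempty index sets. Points of the space are extensional, so restricting them to
  \<open>{..<n}\<close> is the identity and the joint law is \<open>M\<close> itself.\<close>

lemma product_law_indep:
  assumes "n > 0"
  shows "M.indep_vars (\<lambda>_. borel) (\<lambda>i \<omega>. \<omega> i) {..<n}"
proof (subst M.indep_vars_iff_distr_eq_PiM')
  have "distr M (Pi\<^sub>M {..<n} (\<lambda>_. borel)) (\<lambda>\<omega>. \<lambda>i\<in>{..<n}. \<omega> i) = distr M M (\<lambda>\<omega>. \<omega>)"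
    by (rule distr_cong)
       (auto simp: M_def space_PiM PiE_iff extensional_restrict intro!: sets_PiM_cong)
  also have "\<dots> = Pi\<^sub>M {..<n} (\<lambda>i. distr M borel (\<lambda>\<omega>. \<omega> i))"
    by (simp add: distr_id) (auto simp: M_def product_law_component[unfolded M_def] intro!: PiM_cong)
  finally show "distr M (Pi\<^sub>M {..<n} (\<lambda>_. borel)) (\<lambda>\<omega>. \<lambda>i\<in>{..<n}. \<omega> i)
      = Pi\<^sub>M {..<n} (\<lambda>i. distr M borel (\<lambda>\<omega>. \<omega> i))" .
next
  show "{..<n} \<noteq> {}"
    using assms by (simp add: lessThan_empty_iff)
next
  show "M.random_variable borel (\<lambda>\<omega>. \<omega> i)" if "i \<in> {..<n}" for i
    using that by (intro measurable_product_law_component) simp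
qed

lemma product_law_integral_component:
  fixes f :: "real \<Rightarrow> real"
  assumes "i < n" and f: "f \<in> borel_measurable borel"
  shows "integrable M (\<lambda>\<omega>. f (\<omega> i)) \<longleftrightarrow> integrable exp_minus_one_law f"
    and "(\<integral>\<omega>. f (\<omega> i) \<partial>M) = (\<integral>x. f x \<partial>exp_minus_one_law)"
  using integrable_distr_eq[OF measurable_product_law_component[OF \<open>i < n\<close>] f]
    integral_distr[OF measurable_product_law_component[OF \<open>i < n\<close>] f]
  unfolding product_law_component[OF \<open>i < n\<close>] by simp_all

lemma centered_product_law: "centered n M (\<lambda>\<omega>. \<omega>)"
  unfolding centered_def
proof (intro allI impI)
  fix i assume "i < n"
  have id: "(\<lambda>x::real. x) \<in> borel_measurable borel"
    by simp
  show "integrable M (\<lambda>\<omega>. \<omega> i) \<and> (\<integral>\<omega>. \<omega> i \<partial>M) = 0"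
    unfolding product_law_integral_component[OF \<open>i < n\<close> id]
    using exp_minus_one_law_moments(1,2) by (rule conjI)
qed

lemma isotropic_product_law: "isotropic n M (\<lambda>\<omega>. \<omega>)"
  unfolding isotropic_def
proof (intro allI impI)
  fix i j assume ij: "i < n" "j < n"
  show "integrable M (\<lambda>\<omega>. \<omega> i * \<omega> j) \<and> (\<integral>\<omega>. \<omega> i * \<omega> j \<partial>M) = (if i = j then 1 else 0)"
  proof (cases "i = j")
    case True
    have sq: "(\<lambda>x::real. x * x) \<in> borel_measurable borel"
      by simp
    show ?thesis
      unfolding \<open>i = j\<close>[symmetric] product_law_integral_component[OF \<open>i < n\<close> sq]
      using exp_minus_one_law_moments(3,4) by simp
  next
    case False
    \<comment> \<open>Off the diagonal, independence of the pair factors the integral into two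
      vanishing means.\<close>
    have ind: "M.indep_vars (\<lambda>_. borel) (\<lambda>i \<omega>. \<omega> i) {i, j}"
      using ij by (intro M.indep_vars_subset[OF product_law_indep]) auto
    have int: "integrable M (\<lambda>\<omega>. \<omega> k)" "(\<integral>\<omega>. \<omega> k \<partial>M) = 0" if "k \<in> {i, j}" for k
      using centered_product_law ij that by (auto simp: centered_def)
    show ?thesis
      using M.indep_vars_lebesgue_integral[OF _ ind int(1)]
        M.indep_vars_integrable[OF _ ind int(1)] int False by simp
  qed
qed

lemma log_concave_product_law: "log_concave n M (\<lambda>\<omega>. \<omega>)"
  unfolding log_concave_def
proof (intro exI conjI)
  \<comment> \<open>The support is the orthant shifted to have its corner at -1 in every coordinate.
    There the density of \<open>E - 1\<close> is \<open>exp (- (x + 1))\<close>, so the potential is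
    a sum of the terms \<open>x i + 1\<close>.\<close>
  let ?K = "{x \<in> space (lebesgue_Rn n). \<forall>i<n. - 1 \<le> x i}"
  let ?V = "\<lambda>x. \<Sum>i<n. x i + 1 :: real"
  have convex: "- 1 \<le> (1 - t) * a + t * b" if "- 1 \<le> a" "- 1 \<le> b" "0 \<le> t" "t \<le> 1" for a b t :: real
    using convex_bound_le[of "- a" 1 "- b" "1 - t" t] that by simp
  \<comment> \<open>The potential is affine, so its convexity inequality holds with
    equality.\<close>
  have "(\<Sum>i<n. segment_Rn n t x y i + 1) = (1 - t) * ?V x + t * ?V y" for t x y
    by (simp add: segment_Rn_def sum_distrib_left algebra_simps flip: sum.distrib sum_subtractf)
  moreover have "convex_Rn n ?K"
    unfolding convex_Rn_def
  proof (intro conjI ballI)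
    fix x y and t :: real assume "x \<in> ?K" "y \<in> ?K" "t \<in> {0..1}"
    then show "segment_Rn n t x y \<in> ?K"
      by (simp add: segment_Rn_def lebesgue_Rn_def space_PiM convex)
  qed auto
  ultimately show "convex_on_Rn n ?K ?V"
    by (simp add: convex_on_Rn_def)
  have density: "(\<Prod>i<n. ennreal (exponential_density 1 (x i + 1)))
      = (if x \<in> ?K then ennreal (exp (- ?V x)) else 0)" if x: "x \<in> space (lebesgue_Rn n)" for x
  proof (cases "x \<in> ?K")
    case True
    then have "(\<Prod>i<n. ennreal (exponential_density 1 (x i + 1))) = (\<Prod>i<n. ennreal (exp (- (x i + 1))))"
      by (intro prod.cong) (auto simp: exponential_density_def not_less)
    also have "\<dots> = ennreal (exp (- ?V x))"
      by (simp add: prod_ennreal exp_sum flip: sum_negf)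
    finally show ?thesis
      using True by simp
  next
    \<comment> \<open>Outside the orthant some coordinate lies below -1, and its factor kills the
      whole product.\<close>
    case False
    then obtain i where "i < n" "x i < - 1"
      using x False by (auto simp: not_le)
    then have "ennreal (exponential_density 1 (x i + 1)) = 0"
      by (simp add: exponential_density_def)
    then have "(\<Prod>i<n. ennreal (exponential_density 1 (x i + 1))) = 0"
      using \<open>i < n\<close> by (intro prod_zero) auto
    then show ?thesis
      unfolding if_not_P[OF False] .
  qed
  have meas: "(\<lambda>x. if x \<in> ?K then ennreal (exp (- ?V x)) else 0) \<in> borel_measurable (lebesgue_Rn n)"
    unfolding lebesgue_Rn_def by measurable
  have "M = density (lebesgue_Rn n) (\<lambda>x. \<Prod>i<n. ennreal (exponential_density 1 (x i + 1)))"
    unfolding M_def lebesgue_Rn_def exp_minus_one_law_eq_density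
    by (intro PiM_density)
       (auto intro!: sigma_finite_lborel prob_space_imp_sigma_finite
         simp: prob_space_exp_minus_one_law simp flip: exp_minus_one_law_eq_density)
  also have "\<dots> = density (lebesgue_Rn n) (\<lambda>x. if x \<in> ?K then ennreal (exp (- ?V x)) else 0)"
    using meas density
    by (intro density_cong) (auto simp: cong: measurable_cong)
  finally have "M = density (lebesgue_Rn n) (\<lambda>x. if x \<in> ?K then ennreal (exp (- ?V x)) else 0)" .
  moreover have "distr M (lebesgue_Rn n) (\<lambda>\<omega>. \<omega>) = M"
    by (rule distr_id2) (simp add: sets_product_law)
  ultimately show "distributed M (lebesgue_Rn n) (\<lambda>\<omega>. \<omega>)
      (\<lambda>x. if x \<in> ?K then ennreal (exp (- ?V x)) else 0)"
    using meas by (simp add: distributed_def sets_product_law measurable_ident_sets)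
qed

text \<open>Independence factors the characteristic function of the sum, and scaling a coordinate by
  \<open>\<theta> i\<close> moves its argument from \<open>t\<close> to
  \<open>t * \<theta> i\<close>.\<close>

lemma cmod_char_marginal_product_law:
  assumes "n > 0"
  shows "cmod (char (marginal_law n M (\<lambda>\<omega>. \<omega>) \<theta>) t) = (\<Prod>i<n. 1 / sqrt (1 + (t * \<theta> i)\<^sup>2))"
proof -
  have "M.indep_vars (\<lambda>_. borel) (\<lambda>i \<omega>. \<omega> i * \<theta> i) {..<n}"
    by (rule M.indep_vars_compose2[OF product_law_indep[OF assms]]) simp
  then have "char (marginal_law n M (\<lambda>\<omega>. \<omega>) \<theta>) t = (\<Prod>i<n. char (distr M borel (\<lambda>\<omega>. \<omega> i * \<theta> i)) t)"
    unfolding marginal_law_def inner_Rn_def by (rule M.char_distr_sum)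
  also have "\<dots> = (\<Prod>i<n. char exp_minus_one_law (t * \<theta> i))"
  proof (intro prod.cong refl)
    fix i assume "i \<in> {..<n}"
    then have i: "i < n" by simp
    note [measurable] = measurable_product_law_component[OF i]
    show "char (distr M borel (\<lambda>\<omega>. \<omega> i * \<theta> i)) t = char exp_minus_one_law (t * \<theta> i)"
      unfolding product_law_component[OF i, symmetric] char_def
      by (simp add: integral_distr mult_ac)
  qed
  finally show ?thesis
    by (simp add: cmod_char_exp_minus_one_law flip: prod_norm)
qed

text \<open>By the reverse triangle inequality it suffices to compare moduli at 1. Subtracting the
  Gaussian value \<open>exp (- 1 / 2)\<close> from the lower bound for the product leaves
  \<open>exp (- 1 / 2) / (12 * n)\<close>.\<close>

lemma W1_marginal_product_law_lower_bound:
  assumes "\<theta> \<in> sphere_Rn n"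
  shows "ennreal (exp (- 1 / 2) / 12 / n) \<le> W1 (marginal_law n M (\<lambda>\<omega>. \<omega>) \<theta>) gamma1"
proof -
  let ?\<mu> = "marginal_law n M (\<lambda>\<omega>. \<omega>) \<theta>"
  have unit: "(\<Sum>i<n. (\<theta> i)\<^sup>2) = 1"
    using assms by (simp add: sphere_Rn_def inner_Rn_def power2_eq_square)
  \<comment> \<open>In dimension 0 the empty sum would be 0 instead of 1.\<close>
  then have "n > 0"
    by (auto intro: gr0I)
  have gauss: "char gamma1 1 = of_real (exp (- 1 / 2))"
    using fun_cong[OF char_std_normal_distribution, of 1] by (simp add: gamma1_def)
  have "exp (- 1 / 2) / 12 / n \<le> cmod (char ?\<mu> 1) - cmod (char gamma1 1)"
    using prod_inverse_sqrt_lower_bound[OF _ unit] cmod_char_marginal_product_law[OF \<open>n > 0\<close>, of \<theta> 1]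
    by (simp add: gauss algebra_simps)
  also have "\<dots> \<le> cmod (char ?\<mu> 1 - char gamma1 1) / \<bar>1\<bar>"
    by (simp add: norm_triangle_ineq2)
  finally show ?thesis
    using char_diff_le_W1[of ?\<mu> 1 gamma1] by (meson ennreal_leI order_trans)
qed

end

section \<open>Averaging over the sphere\<close>

theorem theorem1p2:
  shows "\<exists>c::real. c > 0 \<and>
    (\<forall>\<^sub>F n in sequentially. \<exists>(M :: (nat \<Rightarrow> real) measure) (X :: (nat \<Rightarrow> real) \<Rightarrow> nat \<Rightarrow> real).
       prob_space M \<and>
       X \<in> measurable M (lebesgue_Rn n) \<and>
       centered n M X \<and> isotropic n M X \<and> log_concave n M X \<and>
       prob_space.indep_vars M (\<lambda>_. borel) (\<lambda>i \<omega>. X \<omega> i) {..<n} \<and>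
       (\<forall>i<n. distr M borel (\<lambda>\<omega>. X \<omega> i) = exp_minus_one_law) \<and>
       (\<forall>\<sigma>. uniform_on_sphere n \<sigma> \<longrightarrow>
          (\<integral>\<^sup>+ \<theta>. W1 (marginal_law n M X \<theta>) gamma1 \<partial>\<sigma>) \<ge> ennreal (c / real n)))"
proof (intro exI[of _ "exp (- 1 / 2) / 12 :: real"] conjI eventually_sequentiallyI[of 1])
  fix n :: nat assume "1 \<le> n"
  let ?M = "Pi\<^sub>M {..<n} (\<lambda>_. exp_minus_one_law)"
  have "ennreal (exp (- 1 / 2) / 12 / n) \<le> (\<integral>\<^sup>+ \<theta>. W1 (marginal_law n ?M (\<lambda>\<omega>. \<omega>) \<theta>) gamma1 \<partial>\<sigma>)"
    if \<sigma>: "uniform_on_sphere n \<sigma>" for \<sigma>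
  proof -
    interpret prob_space \<sigma>
      using \<sigma> by (simp add: uniform_on_sphere_def)
    \<comment> \<open>As \<open>\<sigma>\<close> has total mass 1, the constant is its own integral;
      as its space is the sphere, the pointwise bound applies under the integral.\<close>
    have "ennreal (exp (- 1 / 2) / 12 / n) = (\<integral>\<^sup>+ \<theta>. ennreal (exp (- 1 / 2) / 12 / n) \<partial>\<sigma>)"
      by (simp add: emeasure_space_1)
    also have "\<dots> \<le> (\<integral>\<^sup>+ \<theta>. W1 (marginal_law n ?M (\<lambda>\<omega>. \<omega>) \<theta>) gamma1 \<partial>\<sigma>)"
      using \<sigma> by (intro nn_integral_mono W1_marginal_product_law_lower_bound)
        (simp add: uniform_on_sphere_def)
    finally show ?thesis .
  qed
  then show "\<exists>(M :: (nat \<Rightarrow> real) measure) (X :: (nat \<Rightarrow> real) \<Rightarrow> nat \<Rightarrow> real). prob_space M \<and>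
       X \<in> measurable M (lebesgue_Rn n) \<and>
       centered n M X \<and> isotropic n M X \<and> log_concave n M X \<and>
       prob_space.indep_vars M (\<lambda>_. borel) (\<lambda>i \<omega>. X \<omega> i) {..<n} \<and>
       (\<forall>i<n. distr M borel (\<lambda>\<omega>. X \<omega> i) = exp_minus_one_law) \<and>
       (\<forall>\<sigma>. uniform_on_sphere n \<sigma> \<longrightarrow>
          (\<integral>\<^sup>+ \<theta>. W1 (marginal_law n M X \<theta>) gamma1 \<partial>\<sigma>) \<ge> ennreal (exp (- 1 / 2) / 12 / real n))"
    using \<open>1 \<le> n\<close> prob_space_PiM[of "{..<n}" "\<lambda>_. exp_minus_one_law"] prob_space_exp_minus_one_law
    by (intro exI[of _ ?M] exI[of _ "\<lambda>\<omega>. \<omega> :: nat \<Rightarrow> real"] conjI allI impI)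
       (auto intro!: measurable_ident_sets sets_product_law centered_product_law
         isotropic_product_law log_concave_product_law product_law_indep product_law_component)
qed simp

end
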